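(* Let $G_1,G_2,G_3$ be constants and let $Y_1,Y_2,Y_3$ be coordinates with Poisson bracket $\{Y_1,Y_2\}=\{Y_2,Y_3\}=\{Y_3,Y_1\}=1$. Define $$u=G_{1,2}=e^{Y_1+Y_2}+e^{-Y_1-Y_2}+e^{-Y_1+Y_2}+G_1e^{Y_2}+G_2e^{-Y_1},$$ $$w=G_{2,3}=e^{Y_2+Y_3}+e^{-Y_2-Y_3}+e^{-Y_2+Y_3}+G_2e^{Y_3}+G_3e^{-Y_2},$$ $$v=G_{1,3}=e^{Y_3+Y_1}+e^{-Y_3-Y_1}+e^{-Y_3+Y_1}+G_3e^{Y_1}+G_1e^{-Y_3},$$ $G_\infty=e^{Y_1+Y_2+Y_3}+e^{-Y_1-Y_2-Y_3}$ (which is Poisson-central), and $$r_1=G_1G_2+G_3G_\infty,\quad r_2=G_1G_3+G_2G_\infty,\quad r_3=G_2G_3+G_1G_\infty,$$ $$r_4=-4+G_1G_2G_3G_\infty+G_1^2+G_2^2+G_3^2+G_\infty^2.$$ Let $$\widetilde\phi(u,v,w)=u^2+v^2+w^2-uvw+r_1u+r_2v+r_3w+r_4 .$$ Then the Goldman bracket of the geodesic functions $u,v,w$ coincides with the Etingof–Ginzburg bracket of the cubic $\widetilde\phi$: $$\{u,v\}=\frac{\partial\widetilde\phi}{\partial w},\qquad \{v,w\}=\frac{\partial\widetilde\phi}{\partial u},\qquad \{w,u\}=\frac{\partial\widetilde\phi}{\partial v},$$ and $(u,v,w)$ lies on the cubic surface $M_{\widetilde\phi}$, i.e. $\widetilde\phi(u,v,w)=0$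 identically in $Y_1,Y_2,Y_3$.
   Context: The functions $G_{1,2},G_{2,3},G_{1,3}$ are the geodesic functions, in (shifted) Thurston shear coordinates $Y_1,Y_2,Y_3$, of the three closed geodesics encircling two of the holes/orbifold points numbered $1,2,3$ on a four-holed/orbifold sphere. The parameter $G_i$ is determined by the $i$-th hole/orbifold point, and $G_\infty$ corresponds to the fourth one. The Goldman bracket is the bracket on these functions induced from the constant bracket on the $Y_i$. The coordinates $Y_i$ may be taken real or complex. In the partial derivatives of $\widetilde\phi$, the quantities $u,v,w$ are regarded as independent variables and $r_1,\dots,r_4$ as constants (they are Poisson-central). *)

theory Defs
  imports "HOL-Analysis.Analysis"
begin

text \<open>
  The shear coordinates are the components of a point \<open>Y\<close> of \<open>'a^3\<close>. The scalar type \<open>'a\<close> ranges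
  over the class of complete normed fields over the reals, which contains \<open>real\<close> and \<open>complex\<close>; for
  the latter \<open>deriv\<close> is the complex derivative.
\<close>

definition partial :: "'n \<Rightarrow> ('a::real_normed_field ^ 'n \<Rightarrow> 'a) \<Rightarrow> 'a ^ 'n \<Rightarrow> 'a"
  where "partial i f x = deriv (\<lambda>t. f (\<chi> j. if j = i then t else x $ j)) (x $ i)"

definition shear_matrix :: "'a::real_normed_field ^ 3 ^ 3"
  where "shear_matrix = vector [vector [0, 1, - 1], vector [- 1, 0, 1], vector [1, - 1, 0]]"

text \<open>The Goldman bracket on functions of the shear coordinates: the extension, as a skew
  biderivation, of the constant bracket on the coordinates.\<close>

definition goldman_bracket ::
    "('a::real_normed_field ^ 3 \<Rightarrow> 'a) \<Rightarrow> ('a ^ 3 \<Rightarrow> 'a) \<Rightarrow> 'a ^ 3 \<Rightarrow> 'a"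
  where "goldman_bracket f g Y =
    (\<Sum>i\<in>UNIV. \<Sum>j\<in>UNIV. shear_matrix $ i $ j * partial i f Y * partial j g Y)"

lemma partial_coordinate:
  "partial i (\<lambda>Y. Y $ k) x = (if k = i then 1 else 0)"
  by (simp add: partial_def)

lemma goldman_bracket_coordinates:
  "goldman_bracket (\<lambda>Y. Y $ i) (\<lambda>Y. Y $ j) Y = shear_matrix $ i $ j"
proof -
  have "goldman_bracket (\<lambda>Y. Y $ i) (\<lambda>Y. Y $ j) Y =
      (\<Sum>k\<in>UNIV. \<Sum>l\<in>UNIV. if k = i then (if l = j then shear_matrix $ k $ l else 0) else 0)"
    unfolding goldman_bracket_def partial_coordinate by (intro sum.cong) auto
  also have "\<dots> = (\<Sum>k\<in>UNIV. if k = i then shear_matrix $ k $ j else 0)"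
    by (intro sum.cong) auto
  also have "\<dots> = shear_matrix $ i $ j"
    by simp
  finally show ?thesis .
qed

lemma goldman_bracket_shear_coordinates:
  "goldman_bracket (\<lambda>Y. Y $ 1) (\<lambda>Y. Y $ 2) Y = 1"
  "goldman_bracket (\<lambda>Y. Y $ 2) (\<lambda>Y. Y $ 3) Y = 1"
  "goldman_bracket (\<lambda>Y. Y $ 3) (\<lambda>Y. Y $ 1) Y = 1"
  by (simp_all add: goldman_bracket_coordinates shear_matrix_def)

definition G12 :: "'a \<Rightarrow> 'a \<Rightarrow> 'a::{real_normed_field, banach} ^ 3 \<Rightarrow> 'a"
  where "G12 G1 G2 Y =
    exp (Y $ 1 + Y $ 2) + exp (- Y $ 1 - Y $ 2) + exp (- Y $ 1 + Y $ 2)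
      + G1 * exp (Y $ 2) + G2 * exp (- Y $ 1)"

definition G23 :: "'a \<Rightarrow> 'a \<Rightarrow> 'a::{real_normed_field, banach} ^ 3 \<Rightarrow> 'a"
  where "G23 G2 G3 Y =
    exp (Y $ 2 + Y $ 3) + exp (- Y $ 2 - Y $ 3) + exp (- Y $ 2 + Y $ 3)
      + G2 * exp (Y $ 3) + G3 * exp (- Y $ 2)"

definition G13 :: "'a \<Rightarrow> 'a \<Rightarrow> 'a::{real_normed_field, banach} ^ 3 \<Rightarrow> 'a"
  where "G13 G1 G3 Y =
    exp (Y $ 3 + Y $ 1) + exp (- Y $ 3 - Y $ 1) + exp (- Y $ 3 + Y $ 1)
      + G3 * exp (Y $ 1) + G1 * exp (- Y $ 3)"

definition Ginf :: "'a::{real_normed_field, banach} ^ 3 \<Rightarrow> 'a"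
  where "Ginf Y = exp (Y $ 1 + Y $ 2 + Y $ 3) + exp (- Y $ 1 - Y $ 2 - Y $ 3)"

text \<open>The cubic as a function of the point \<open>x = (u, v, w)\<close>, with constant coefficients.\<close>

definition cubic :: "'a \<Rightarrow> 'a \<Rightarrow> 'a \<Rightarrow> 'a \<Rightarrow> 'a::real_normed_field ^ 3 \<Rightarrow> 'a"
  where "cubic r1 r2 r3 r4 x =
    (x $ 1)^2 + (x $ 2)^2 + (x $ 3)^2 - x $ 1 * x $ 2 * x $ 3
      + r1 * x $ 1 + r2 * x $ 2 + r3 * x $ 3 + r4"

definition cubic_surface :: "('a::real_normed_field ^ 3 \<Rightarrow> 'a) \<Rightarrow> ('a ^ 3) set"
  where "cubic_surface \<phi> = {x. \<phi> x = 0}"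

end

(*
  In the variables exp Y_i and their inverses, each Poisson relation and the cubic equation is a
  Laurent polynomial identity, that is, it lies in the ideal generated by
  exp Y_i * exp (- Y_i) - 1.  The function Ginf is a Casimir because its three partial derivatives
  agree while the rows of the shear matrix sum to zero.
*)

theory Submission
  imports Defs
begin

text \<open>\<open>deriv\<close> is defined by choice, so exhibiting one derivative of the
  one-variable restriction determines it. This brings \<open>partial\<close> within reach of
  \<open>derivative_eq_intros\<close>.\<close>

lemma partial_eqI:
  assumes "((\<lambda>t. f (\<chi> j. if j = i then t else x $ j)) has_field_derivative D) (at (x $ i))"
  shows "partial i f x = D"
  using assms unfolding partial_def by (rule DERIV_imp_deriv)

lemma goldman_bracket_expand:
  "goldman_bracket f g Y =
     (partial 1 f Y * partial 2 g Y - partial 2 f Y * partial 1 g Y) +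
     (partial 2 f Y * partial 3 g Y - partial 3 f Y * partial 2 g Y) +
     (partial 3 f Y * partial 1 g Y - partial 1 f Y * partial 3 g Y)"
  by (simp add: goldman_bracket_def shear_matrix_def sum_3)

text \<open>The coefficients are fixed parameters here, so values involving \<open>Ginf Y\<close>
  can later be substituted for them without contributing to the derivatives.\<close>

lemma partial_cubic:
  "partial 1 (cubic r1 r2 r3 r4) x = 2 * x $ 1 - x $ 2 * x $ 3 + r1"
  "partial 2 (cubic r1 r2 r3 r4) x = 2 * x $ 2 - x $ 1 * x $ 3 + r2"
  "partial 3 (cubic r1 r2 r3 r4) x = 2 * x $ 3 - x $ 1 * x $ 2 + r3"
  by (rule partial_eqI; unfold cubic_def; force intro!: derivative_eq_intros)+

lemma partial_G12:
  "partial 1 (G12 G1 G2) Y =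
     exp (Y $ 1 + Y $ 2) - exp (- Y $ 1 - Y $ 2) - exp (- Y $ 1 + Y $ 2) - G2 * exp (- Y $ 1)"
  "partial 2 (G12 G1 G2) Y =
     exp (Y $ 1 + Y $ 2) - exp (- Y $ 1 - Y $ 2) + exp (- Y $ 1 + Y $ 2) + G1 * exp (Y $ 2)"
  "partial 3 (G12 G1 G2) Y = 0"
  by (rule partial_eqI; unfold G12_def; force intro!: derivative_eq_intros)+

lemma partial_G23:
  "partial 1 (G23 G2 G3) Y = 0"
  "partial 2 (G23 G2 G3) Y =
     exp (Y $ 2 + Y $ 3) - exp (- Y $ 2 - Y $ 3) - exp (- Y $ 2 + Y $ 3) - G3 * exp (- Y $ 2)"
  "partial 3 (G23 G2 G3) Y =
     exp (Y $ 2 + Y $ 3) - exp (- Y $ 2 - Y $ 3) + exp (- Y $ 2 + Y $ 3) + G2 * exp (Y $ 3)"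
  by (rule partial_eqI; unfold G23_def; force intro!: derivative_eq_intros)+

lemma partial_G13:
  "partial 1 (G13 G1 G3) Y =
     exp (Y $ 3 + Y $ 1) - exp (- Y $ 3 - Y $ 1) + exp (- Y $ 3 + Y $ 1) + G3 * exp (Y $ 1)"
  "partial 2 (G13 G1 G3) Y = 0"
  "partial 3 (G13 G1 G3) Y =
     exp (Y $ 3 + Y $ 1) - exp (- Y $ 3 - Y $ 1) - exp (- Y $ 3 + Y $ 1) - G1 * exp (- Y $ 3)"
  by (rule partial_eqI; unfold G13_def; force intro!: derivative_eq_intros)+

lemma partial_Ginf:
  "partial i Ginf Y = exp (Y $ 1 + Y $ 2 + Y $ 3) - exp (- Y $ 1 - Y $ 2 - Y $ 3)"
  using exhaust_3[of i]
  by (elim disjE; hypsubst) (rule partial_eqI; unfold Ginf_def; force intro!: derivative_eq_intros)+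

text \<open>The common partial of \<open>Ginf\<close> factors out, and the partials of
  \<open>f\<close> cancel in pairs whatever values \<open>deriv\<close> gives them, so
  \<open>f\<close> may be arbitrary.\<close>

lemma goldman_bracket_Ginf: "goldman_bracket Ginf f Y = 0"
  by (simp add: goldman_bracket_expand partial_Ginf algebra_simps)

text \<open>Reduces every exponential to the six atoms \<open>exp (Y $ i)\<close> and
  \<open>exp (- Y $ i)\<close>. The triple difference has its own rule because its left part is not
  syntactically a negation.\<close>

lemma exp_shear_products:
  fixes x y z :: "'a::{real_normed_field, banach}"
  shows "exp (x + y) = exp x * exp y"
    and "exp (- x + y) = exp (- x) * exp y"
    and "exp (- x - y) = exp (- x) * exp (- y)"
    and "exp (- x - y - z) = exp (- x) * exp (- y) * exp (- z)"
  by (simp_all flip: exp_add)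

text \<open>The right side is \<open>2 * w - u * v + r3\<close>, the value that
  \<open>partial_cubic\<close> gives in direction 3. The next two lemmas do the same for directions
  1 and 2.\<close>

lemma goldman_bracket_G12_G13:
  "goldman_bracket (G12 G1 G2) (G13 G1 G3) Y =
     2 * G23 G2 G3 Y - G12 G1 G2 Y * G13 G1 G3 Y + (G2 * G3 + G1 * Ginf Y)"
proof -
  have inv: "exp (Y $ i) * exp (- Y $ i) = 1" for i
    by (rule exp_minus_inverse)
  show ?thesis
    unfolding goldman_bracket_expand partial_G12 partial_G23 partial_G13
      G12_def G23_def G13_def Ginf_def exp_shear_products
    using inv[of 1] inv[of 2] inv[of 3] by algebra
qed

lemma goldman_bracket_G13_G23:
  "goldman_bracket (G13 G1 G3) (G23 G2 G3) Y =
     2 * G12 G1 G2 Y - G13 G1 G3 Y * G23 G2 G3 Y + (G1 * G2 + G3 * Ginf Y)"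
proof -
  have inv: "exp (Y $ i) * exp (- Y $ i) = 1" for i
    by (rule exp_minus_inverse)
  show ?thesis
    unfolding goldman_bracket_expand partial_G12 partial_G23 partial_G13
      G12_def G23_def G13_def Ginf_def exp_shear_products
    using inv[of 1] inv[of 2] inv[of 3] by algebra
qed

lemma goldman_bracket_G23_G12:
  "goldman_bracket (G23 G2 G3) (G12 G1 G2) Y =
     2 * G13 G1 G3 Y - G12 G1 G2 Y * G23 G2 G3 Y + (G1 * G3 + G2 * Ginf Y)"
proof -
  have inv: "exp (Y $ i) * exp (- Y $ i) = 1" for i
    by (rule exp_minus_inverse)
  show ?thesis
    unfolding goldman_bracket_expand partial_G12 partial_G23 partial_G13
      G12_def G23_def G13_def Ginf_def exp_shear_products
    using inv[of 1] inv[of 2] inv[of 3] by algebra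
qed

text \<open>Up to signs, this is the Fricke relation between traces on the four-holed
  sphere.\<close>

lemma geodesic_functions_cubic:
  "(G12 G1 G2 Y)^2 + (G13 G1 G3 Y)^2 + (G23 G2 G3 Y)^2 - G12 G1 G2 Y * G13 G1 G3 Y * G23 G2 G3 Y
     + (G1 * G2 + G3 * Ginf Y) * G12 G1 G2 Y + (G1 * G3 + G2 * Ginf Y) * G13 G1 G3 Y
     + (G2 * G3 + G1 * Ginf Y) * G23 G2 G3 Y
     + (- 4 + G1 * G2 * G3 * Ginf Y + G1^2 + G2^2 + G3^2 + (Ginf Y)^2) = 0"
proof -
  have inv: "exp (Y $ i) * exp (- Y $ i) = 1" for i
    by (rule exp_minus_inverse)
  show ?thesis
    unfolding G12_def G23_def G13_def Ginf_def exp_shear_products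
    using inv[of 1] inv[of 2] inv[of 3] by algebra
qed

theorem mainTheorem4:
  fixes G1 G2 G3 :: "'a::{real_normed_field, banach}"
  shows
    "(\<forall>f (Y :: 'a ^ 3). goldman_bracket Ginf f Y = 0) \<and>
     (\<forall>Y :: 'a ^ 3.
        let u = G12 G1 G2;
            w = G23 G2 G3;
            v = G13 G1 G3;
            g = Ginf Y;
            r1 = G1 * G2 + G3 * g;
            r2 = G1 * G3 + G2 * g;
            r3 = G2 * G3 + G1 * g;
            r4 = - 4 + G1 * G2 * G3 * g + G1^2 + G2^2 + G3^2 + g^2;
            \<phi> = cubic r1 r2 r3 r4;
            p = vector [u Y, v Y, w Y]
        in goldman_bracket u v Y = partial 3 \<phi> p \<and>
           goldman_bracket v w Y = partial 1 \<phi> p \<and>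
           goldman_bracket w u Y = partial 2 \<phi> p \<and>
           p \<in> cubic_surface \<phi>)"
  \<comment> \<open>The skipped argument is \<open>Y\<close>, so the relation is available at every
    point. Its left side is the cubic evaluated at \<open>p\<close>.\<close>
  using geodesic_functions_cubic [of G1 G2 _ G3]
  by (simp add: Let_def goldman_bracket_Ginf partial_cubic goldman_bracket_G12_G13
      goldman_bracket_G13_G23 goldman_bracket_G23_G12 cubic_surface_def cubic_def)

end
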